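(* If $d=7q+\beta$ with integers $q\ge 1$ and $0\le\beta\le 6$, then \[ \gamma(T_d)\le 3.5q^2+(\beta+4.5)q+\beta-1 . \]
   Context: Let $\alpha_1=(1,0)$ and $\alpha_2=(-\tfrac12,\tfrac{\sqrt3}{2})$. The triangular lattice $T_\infty$ is the infinite graph with vertex set $\{a\alpha_1+b\alpha_2 : a,b\in\mathbb Z\}$, two vertices being adjacent iff their Euclidean distance is $1$. For an integer $d\ge 0$, the triangular matchstick graph $T_d$ is the subgraph of $T_\infty$ induced by the vertices $a\alpha_1+b\alpha_2$ with $0\le b\le a\le d$. $\gamma(G)$ denotes the domination number of $G$: the minimum size of a set $D\subseteq V(G)$ such that every vertex of $G$ is in $D$ or adjacent to a vertex of $D$. *)

theory Defs
  imports Complex_Main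
begin

definition alpha1 :: complex where "alpha1 = Complex 1 0"
definition alpha2 :: complex where "alpha2 = Complex (-1/2) (sqrt 3 / 2)"

definition lattice_pt :: "int \<times> int \<Rightarrow> complex" where
  "lattice_pt p = of_int (fst p) * alpha1 + of_int (snd p) * alpha2"

definition tri_adj :: "int \<times> int \<Rightarrow> int \<times> int \<Rightarrow> bool" where
  "tri_adj p r \<longleftrightarrow> dist (lattice_pt p) (lattice_pt r) = 1"

(* vertex set of the triangular matchstick graph T_d (induced subgraph) *)
definition T_verts :: "nat \<Rightarrow> (int \<times> int) set" where
  "T_verts d = {(a, b). 0 \<le> b \<and> b \<le> a \<and> a \<le> int d}"

definition dominating :: "'a set \<Rightarrow> ('a \<Rightarrow> 'a \<Rightarrow> bool) \<Rightarrow> 'a set \<Rightarrow> bool" where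
  "dominating V adj D \<longleftrightarrow> D \<subseteq> V \<and> (\<forall>v\<in>V. v \<in> D \<or> (\<exists>u\<in>D. adj v u))"

definition domination_number :: "'a set \<Rightarrow> ('a \<Rightarrow> 'a \<Rightarrow> bool) \<Rightarrow> nat" where
  "domination_number V adj = Min {card D | D. dominating V adj D}"

(* induced subgraph: adjacency restricted to the vertex set V is captured since D \<subseteq> V and v \<in> V *)

end

theory Submission
  imports Defs
begin

text \<open>
  The points with \<open>a + 2 b \<equiv> c (mod 7)\<close> form a perfect code of the triangular lattice: their
  closed neighbourhoods tile it. Intersecting the code with the triangle enlarged by one layer on
  each side gives a set whose closed neighbourhoods cover \<open>T_d\<close>, and every point of the
  outer layer can be replaced by a vertex of \<open>T_d\<close> with at least the same coverage. This costs
  \<open>3.5 q\<^sup>2 + (\<beta> + 4.5) q + const\<close>, where the constant is 2 or 3 too large for most classes \<open>c\<close>. The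
  excess is removed at the corners: depending on the class of the code relative to a corner, some
  \<open>m + 1\<close> code points near it can be exchanged for \<open>m\<close> vertices. For each \<open>\<beta>\<close> there is a
  class \<open>c\<close> for which the three corners together save enough.
\<close>

section \<open>Neighbourhoods, the perfect code, and the rotation\<close>

text \<open>The offsets are zero and the six units of the norm form
  \<open>x^2 - x * y + y^2\<close>. The basis vectors form an angle of 120 degrees, so
  \<open>(1, 1)\<close> is a unit and \<open>(1, -1)\<close> is not.\<close>

definition near :: "int \<times> int \<Rightarrow> int \<times> int \<Rightarrow> bool" where
  "near p r \<longleftrightarrow> (fst r - fst p, snd r - snd p)
     \<in> {(0, 0), (1, 0), (-1, 0), (0, 1), (0, -1), (1, 1), (-1, -1)}"

lemma near_iff:
  "near (a, b) (a', b') \<longleftrightarrow>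
     (a' = a \<and> b' = b) \<or> (a' = a + 1 \<and> b' = b) \<or> (a' = a - 1 \<and> b' = b) \<or> (a' = a \<and> b' = b + 1) \<or>
     (a' = a \<and> b' = b - 1) \<or> (a' = a + 1 \<and> b' = b + 1) \<or> (a' = a - 1 \<and> b' = b - 1)"
  by (simp add: near_def diff_eq_eq add.commute)

lemma near_imp_tri_adj:
  assumes "near p r" "p \<noteq> r"
  shows "tri_adj p r"
proof -
  obtain a b where p: "p = (a, b)" by fastforce
  obtain a' b' where r: "r = (a', b')" by fastforce
  define x y where "x = a - a'" and "y = b - b'"
  have "x\<^sup>2 - x * y + y\<^sup>2 = 1"
    using assms unfolding p r near_iff x_def y_def by (elim disjE conjE) simp_all
  then have "real_of_int (x\<^sup>2 - x * y + y\<^sup>2) = 1" by simp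
  then have *: "(real_of_int x)\<^sup>2 - real_of_int x * real_of_int y + (real_of_int y)\<^sup>2 = 1" by simp
  have "lattice_pt p - lattice_pt r = Complex (of_int x - of_int y / 2) (of_int y * sqrt 3 / 2)"
    by (simp add: p r lattice_pt_def alpha1_def alpha2_def complex_eq_iff x_def y_def field_simps)
  moreover have "(real_of_int x - of_int y / 2)\<^sup>2 + (of_int y * sqrt 3 / 2)\<^sup>2 = 1"
    using * by (simp add: power2_diff power_mult_distrib power_divide field_simps)
  ultimately show ?thesis
    by (simp add: tri_adj_def dist_norm cmod_def)
qed

text \<open>The inequalities describe the triangle with one more layer on each side; its tips are
  \<open>(-2, -1)\<close>, \<open>(d + 1, -1)\<close> and \<open>(d + 1, d + 2)\<close>.\<close>

definition ext_code :: "nat \<Rightarrow> int \<Rightarrow> (int \<times> int) set" where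
  "ext_code d c = {(a, b). - 1 \<le> b \<and> b - 1 \<le> a \<and> a \<le> int d + 1 \<and> (a + 2 * b - c) mod 7 = 0}"

text \<open>The symmetry of order 3 of the triangle: it sends \<open>(0, 0)\<close> to
  \<open>(d, 0)\<close>, that to \<open>(d, d)\<close>, and that back to
  \<open>(0, 0)\<close>.\<close>

definition rot :: "nat \<Rightarrow> int \<times> int \<Rightarrow> int \<times> int" where
  "rot d p = (int d - snd p, fst p - snd p)"

definition rot_inv :: "nat \<Rightarrow> int \<times> int \<Rightarrow> int \<times> int" where
  "rot_inv d p = (int d - fst p + snd p, int d - fst p)"

lemma rot_rot_inv [simp]: "rot d (rot_inv d p) = p" "rot_inv d (rot d p) = p"
  by (simp_all add: rot_def rot_inv_def)

lemma near_rot_iff [simp]: "near (rot d p) (rot d r) \<longleftrightarrow> near p r"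
proof -
  define x y where "x = fst r - fst p" and "y = snd r - snd p"
  have "fst (rot d r) - fst (rot d p) = - y" "snd (rot d r) - snd (rot d p) = x - y"
    by (simp_all add: rot_def x_def y_def)
  moreover have "(- y, x - y) \<in> {(0, 0), (1, 0), (-1, 0), (0, 1), (0, -1), (1, 1), (-1, -1)} \<longleftrightarrow>
      (x, y) \<in> {(0, 0), (1, 0), (-1, 0), (0, 1), (0, -1), (1, 1), (-1, -1)}"
    by auto
  ultimately show ?thesis by (simp only: near_def x_def y_def)
qed

lemma rot_in_T_verts_iff [simp]: "rot d p \<in> T_verts d \<longleftrightarrow> p \<in> T_verts d"
  by (cases p) (auto simp: rot_def T_verts_def)

text \<open>Modulo 7 the rotation multiplies \<open>a + 2 * b - c\<close> by 2, which is
  invertible.\<close>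

lemma rot_in_ext_code_iff: "rot d p \<in> ext_code d (int d + 2 * c) \<longleftrightarrow> p \<in> ext_code d c"
proof -
  obtain a b where p: "p = (a, b)" by fastforce
  have "int d - b + 2 * (a - b) - (int d + 2 * c) = 2 * (a + 2 * b - c) - 7 * b" by simp
  moreover have "(2 * t - 7 * b) mod 7 = 0 \<longleftrightarrow> t mod 7 = 0" for t :: int by presburger
  ultimately have "(int d - b + 2 * (a - b) - (int d + 2 * c)) mod 7 = 0 \<longleftrightarrow> (a + 2 * b - c) mod 7 = 0"
    by (simp only:)
  moreover have "- 1 \<le> a - b \<and> a - b - 1 \<le> int d - b \<and> int d - b \<le> int d + 1 \<longleftrightarrow>
      - 1 \<le> b \<and> b - 1 \<le> a \<and> a \<le> int d + 1"
    by auto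
  ultimately show ?thesis
    unfolding p rot_def ext_code_def mem_Collect_eq prod.case fst_conv snd_conv by argo
qed

lemma finite_T_verts: "finite (T_verts d)"
  by (rule finite_subset[of _ "{0..int d} \<times> {0..int d}"]) (auto simp: T_verts_def)

lemma finite_ext_code: "finite (ext_code d c)"
  by (rule finite_subset[of _ "{- 2..int d + 2} \<times> {- 2..int d + 2}"]) (auto simp: ext_code_def)

text \<open>The seven offsets change \<open>a + 2 * b\<close> by 0, 1, -1, 2, -2, 3, -3, hence reach
  every class; the extra layer contains all neighbours of a vertex.\<close>

lemma ext_code_covers:
  assumes "v \<in> T_verts d"
  shows "\<exists>u\<in>ext_code d c. near u v"
proof -
  obtain a b where v: "v = (a, b)" by fastforce
  have ab: "0 \<le> b" "b \<le> a" "a \<le> int d" using assms by (auto simp: v T_verts_def)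
  have "(a + 2 * b - c) mod 7 = 0 \<or> (a + 1 + 2 * b - c) mod 7 = 0 \<or> (a - 1 + 2 * b - c) mod 7 = 0 \<or>
    (a + 2 * (b + 1) - c) mod 7 = 0 \<or> (a + 2 * (b - 1) - c) mod 7 = 0 \<or>
    (a + 1 + 2 * (b + 1) - c) mod 7 = 0 \<or> (a - 1 + 2 * (b - 1) - c) mod 7 = 0"
    by presburger
  then have "\<exists>u\<in>{(a, b), (a + 1, b), (a - 1, b), (a, b + 1), (a, b - 1), (a + 1, b + 1), (a - 1, b - 1)}.
      u \<in> ext_code d c"
    using ab by (elim disjE) (auto simp: ext_code_def)
  moreover have "near u v" if "u \<in> {(a, b), (a + 1, b), (a - 1, b), (a, b + 1), (a, b - 1),
      (a + 1, b + 1), (a - 1, b - 1)}" for u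
    using that by (auto simp: v near_iff)
  ultimately show ?thesis by blast
qed

text \<open>A point of the outer layer sees at most two vertices; these are consecutive on one side
  of the triangle, so a vertex of that side covers both.\<close>

lemma ext_code_replaceable:
  assumes "u \<in> ext_code d c"
  shows "\<exists>w\<in>T_verts d. \<forall>v\<in>T_verts d. near u v \<longrightarrow> near w v"
proof -
  obtain a b where u: "u = (a, b)" by fastforce
  have ab: "- 1 \<le> b" "b - 1 \<le> a" "a \<le> int d + 1" using assms by (auto simp: u ext_code_def)
  \<comment> \<open>Clamping to \<open>0..d\<close> handles the ends of a side, where one or both of
    the two positions leave the triangle.\<close>
  define e where "e t = max 0 (min (int d) t)" for t
  have e: "0 \<le> e t" "e t \<le> int d" "\<And>z. 0 \<le> z \<Longrightarrow> z \<le> int d \<Longrightarrow> z = t \<or> z = t + 1 \<Longrightarrow> z = e t \<or> z = e t + 1"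
    for t unfolding e_def by linarith+
  consider "u \<in> T_verts d" | "b = - 1" | "b = a + 1" "b \<noteq> - 1" | "a = int d + 1" "b \<noteq> - 1" "b \<noteq> a + 1"
    using ab by (force simp: u T_verts_def)
  then show ?thesis
  proof cases
    case 1
    then show ?thesis by blast
  next
    case 2
    have "near (e a, 0) v" if "v \<in> T_verts d" "near u v" for v
    proof -
      obtain x y where v: "v = (x, y)" by fastforce
      have "y = 0" "x = a \<or> x = a + 1" "0 \<le> x" "x \<le> int d"
        using that 2 by (auto simp: u v T_verts_def near_iff)
      then show ?thesis using e(3)[of x a] by (auto simp: v near_iff)
    qed
    moreover have "(e a, 0) \<in> T_verts d" using e by (simp add: T_verts_def)
    ultimately show ?thesis by blast
  next
    case 3
    have "near (e a, e a) v" if "v \<in> T_verts d" "near u v" for v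
    proof -
      obtain x y where v: "v = (x, y)" by fastforce
      have "y = x" "x = a \<or> x = a + 1" "0 \<le> x" "x \<le> int d"
        using that 3 by (auto simp: u v T_verts_def near_iff)
      then show ?thesis using e(3)[of x a] by (auto simp: v near_iff)
    qed
    moreover have "(e a, e a) \<in> T_verts d" using e by (simp add: T_verts_def)
    ultimately show ?thesis by blast
  next
    case 4
    have "near (int d, e (b - 1)) v" if "v \<in> T_verts d" "near u v" for v
    proof -
      obtain x y where v: "v = (x, y)" by fastforce
      have "x = int d" "y = b - 1 \<or> y = b" "0 \<le> y" "y \<le> int d"
        using that 4 by (auto simp: u v T_verts_def near_iff)
      then show ?thesis using e(3)[of y "b - 1"] by (auto simp: v near_iff)
    qed
    moreover have "(int d, e (b - 1)) \<in> T_verts d" using e by (simp add: T_verts_def)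
    ultimately show ?thesis by blast
  qed
qed

section \<open>Exchanging code points\<close>

text \<open>\<open>R\<close> is given up in exchange for \<open>A\<close>. The region
  \<open>Z\<close> confines \<open>R\<close>, so that exchanges at different corners can be shown to
  be disjoint.\<close>

definition saving :: "nat \<Rightarrow> int \<Rightarrow> nat \<Rightarrow> (int \<times> int) set \<Rightarrow> bool" where
  "saving d c k Z \<longleftrightarrow> (\<exists>R A. R \<subseteq> ext_code d c \<inter> Z \<and> A \<subseteq> T_verts d \<and> card A + k \<le> card R \<and>
     (\<forall>u\<in>R. \<forall>v\<in>T_verts d. near u v \<longrightarrow> (\<exists>w\<in>A. near w v)))"

lemma saving_0: "saving d c 0 Z"
  unfolding saving_def by (intro exI[of _ "{}"]) auto

lemma saving_Un:
  assumes "saving d c k Z" "saving d c k' Z'" "ext_code d c \<inter> Z \<inter> Z' = {}"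
  shows "saving d c (k + k') (Z \<union> Z')"
proof -
  obtain R A where 1: "R \<subseteq> ext_code d c \<inter> Z" "A \<subseteq> T_verts d" "card A + k \<le> card R"
     "\<forall>u\<in>R. \<forall>v\<in>T_verts d. near u v \<longrightarrow> (\<exists>w\<in>A. near w v)"
    using assms(1) unfolding saving_def by blast
  obtain R' A' where 2: "R' \<subseteq> ext_code d c \<inter> Z'" "A' \<subseteq> T_verts d" "card A' + k' \<le> card R'"
     "\<forall>u\<in>R'. \<forall>v\<in>T_verts d. near u v \<longrightarrow> (\<exists>w\<in>A'. near w v)"
    using assms(2) unfolding saving_def by blast
  have "finite R" "finite R'" using 1(1) 2(1) finite_ext_code by (meson finite_subset le_inf_iff)+
  moreover have "R \<inter> R' = {}" using 1(1) 2(1) assms(3) by blast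
  ultimately have "card (R \<union> R') = card R + card R'" by (rule card_Un_disjoint)
  moreover have "card (A \<union> A') \<le> card A + card A'" by (rule card_Un_le)
  ultimately have "card (A \<union> A') + (k + k') \<le> card (R \<union> R')" using 1(3) 2(3) by linarith
  then show ?thesis
    unfolding saving_def using 1 2 by (intro exI[of _ "R \<union> R'"] exI[of _ "A \<union> A'"]) blast
qed

lemma saving_rot:
  assumes "saving d (int d + 2 * c) k Z"
  shows "saving d c k (rot d -` Z)"
proof -
  obtain R A where *: "R \<subseteq> ext_code d (int d + 2 * c) \<inter> Z" "A \<subseteq> T_verts d" "card A + k \<le> card R"
     "\<forall>u\<in>R. \<forall>v\<in>T_verts d. near u v \<longrightarrow> (\<exists>w\<in>A. near w v)"
    using assms unfolding saving_def by blast
  have inj: "inj_on (rot_inv d) X" for X by (rule inj_on_inverseI[of _ "rot d"]) simp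
  have "rot_inv d p \<in> ext_code d c \<inter> rot d -` Z" if "p \<in> R" for p
    using that *(1) rot_in_ext_code_iff[of d "rot_inv d p" c] by auto
  moreover have "rot_inv d p \<in> T_verts d" if "p \<in> A" for p
    using that *(2) rot_in_T_verts_iff[of d "rot_inv d p"] by auto
  moreover have "\<exists>w\<in>rot_inv d ` A. near w v"
    if uv: "u \<in> R" "v \<in> T_verts d" "near (rot_inv d u) v" for u v
  proof -
    have "near u (rot d v)" using uv(3) near_rot_iff[of d "rot_inv d u" v] by simp
    then obtain w where "w \<in> A" "near w (rot d v)"
      using *(4) uv(1,2) rot_in_T_verts_iff by blast
    then show ?thesis using near_rot_iff[of d "rot_inv d w" v] by auto
  qed
  ultimately show ?thesis
    unfolding saving_def using *(3)
    by (intro exI[of _ "rot_inv d ` R"] exI[of _ "rot_inv d ` A"])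
      (auto simp: card_image[OF inj] simp del: vimage_eq)
qed

text \<open>A vertex covered by a point of \<open>R\<close> is covered by \<open>A\<close>; the
  remaining code points are moved into the triangle, which loses no coverage.\<close>

lemma saving_domination_number:
  assumes "saving d c k Z"
  shows "domination_number (T_verts d) tri_adj + k \<le> card (ext_code d c)"
proof -
  obtain R A where *: "R \<subseteq> ext_code d c \<inter> Z" "A \<subseteq> T_verts d" "card A + k \<le> card R"
     "\<forall>u\<in>R. \<forall>v\<in>T_verts d. near u v \<longrightarrow> (\<exists>w\<in>A. near w v)"
    using assms unfolding saving_def by blast
  have "\<forall>u\<in>ext_code d c. \<exists>w. w \<in> T_verts d \<and> (\<forall>v\<in>T_verts d. near u v \<longrightarrow> near w v)"
    using ext_code_replaceable by blast
  from bchoice[OF this] obtain f where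
    f: "\<forall>u\<in>ext_code d c. f u \<in> T_verts d \<and> (\<forall>v\<in>T_verts d. near u v \<longrightarrow> near (f u) v)"
    by blast
  have R: "R \<subseteq> ext_code d c" using *(1) by blast
  define D where "D = A \<union> f ` (ext_code d c - R)"
  have "D \<subseteq> T_verts d" using *(2) f by (auto simp: D_def)
  moreover have "v \<in> D \<or> (\<exists>w\<in>D. tri_adj v w)" if v: "v \<in> T_verts d" for v
  proof -
    obtain u where "u \<in> ext_code d c" "near u v" using ext_code_covers[OF v] by blast
    then have "\<exists>w\<in>D. near w v"
      using *(4) f v unfolding D_def by (cases "u \<in> R") blast+
    then obtain w where "w \<in> D" "near w v" by blast
    then show ?thesis
      using near_imp_tri_adj[of w v] unfolding tri_adj_def dist_commute[of "lattice_pt v"] by blast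
  qed
  ultimately have "dominating (T_verts d) tri_adj D" by (simp add: dominating_def)
  moreover have "finite {card D | D. dominating (T_verts d) tri_adj D}"
    by (rule finite_surj[of "Pow (T_verts d)" _ card])
      (use finite_T_verts in \<open>auto simp: dominating_def\<close>)
  ultimately have "domination_number (T_verts d) tri_adj \<le> card D"
    unfolding domination_number_def by (intro Min_le) blast+
  also have "card D \<le> card A + card (ext_code d c - R)"
    unfolding D_def using card_Un_le[of A "f ` (ext_code d c - R)"]
      card_image_le[OF finite_Diff[OF finite_ext_code[of d c]], of f R] by linarith
  also have "card (ext_code d c - R) = card (ext_code d c) - card R"
    using R by (intro card_Diff_subset) (auto intro: finite_subset[OF _ finite_ext_code])
  finally show ?thesis
    using *(3) card_mono[OF finite_ext_code R] by linarith
qed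

section \<open>Savings at the corners\<close>

text \<open>Rotating the second and third corner to \<open>(0, 0)\<close> turns the class \<open>c\<close> of the code into
  \<open>d + 2 c\<close> and \<open>3 d + 4 c\<close>.\<close>

lemma saving_three_corners:
  assumes "saving d c k1 {p. fst p \<le> r1}" "saving d (int d + 2 * c) k2 {p. fst p \<le> r2}"
    and "saving d (3 * int d + 4 * c) k3 {p. fst p \<le> r3}"
    and "r1 + r2 < int d - 1" "r2 + r3 < int d - 1" "r3 + r1 < int d - 1"
  shows "domination_number (T_verts d) tri_adj + (k1 + k2 + k3) \<le> card (ext_code d c)"
proof -
  let ?Z1 = "{p. fst p \<le> r1}" and ?Z2 = "rot d -` {p. fst p \<le> r2}"
    and ?Z3 = "rot d -` (rot d -` {p. fst p \<le> r3})"
  have 2: "saving d c k2 ?Z2" by (rule saving_rot[OF assms(2)])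
  have "int d + 2 * (int d + 2 * c) = 3 * int d + 4 * c" by simp
  then have 3: "saving d c k3 ?Z3" using assms(3) by (metis saving_rot)
  have "saving d c (k1 + k2) (?Z1 \<union> ?Z2)"
    \<comment> \<open>A common point would have \<open>a \<le> r1\<close> and
      \<open>b \<ge> d - r2\<close>. Since the outer layer allows \<open>b = a + 1\<close>,
      excluding it takes \<open>r1 + r2 < d - 1\<close>.\<close>
    by (rule saving_Un[OF assms(1) 2]) (use assms(4) in \<open>auto simp: ext_code_def rot_def\<close>)
  then have "saving d c (k1 + k2 + k3) (?Z1 \<union> ?Z2 \<union> ?Z3)"
    by (rule saving_Un[OF _ 3]) (use assms(5,6) in \<open>auto simp: ext_code_def rot_def\<close>)
  then show ?thesis by (rule saving_domination_number)
qed

text \<open>An explicit image, so that \<open>simp\<close> can enumerate the neighbours of concrete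
  points.\<close>

definition nbhd :: "int \<times> int \<Rightarrow> (int \<times> int) set" where
  "nbhd p = (\<lambda>e. (fst p + fst e, snd p + snd e)) `
     {(0, 0), (1, 0), (-1, 0), (0, 1), (0, -1), (1, 1), (-1, -1)}"

lemma near_imp_in_nbhd: "near p r \<Longrightarrow> r \<in> nbhd p"
  unfolding near_def nbhd_def
  by (rule image_eqI[of _ _ "(fst r - fst p, snd r - snd p)"]) simp_all

lemma savingI:
  assumes "R \<subseteq> ext_code d c \<inter> Z" "A \<subseteq> T_verts d" "card A + k \<le> card R"
    and "\<forall>u\<in>R. \<forall>v\<in>nbhd u. v \<in> T_verts d \<longrightarrow> (\<exists>w\<in>A. near w v)"
  shows "saving d c k Z"
  unfolding saving_def
  by (intro exI[of _ R] exI[of _ A] conjI ballI impI) (use assms near_imp_in_nbhd in blast)+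

text \<open>The suffix is the class \<open>c mod 7\<close>; the exchange sets come from an exhaustive search near the
  corner \<open>(0, 0)\<close>. In class 3 the dropped point is the tip of the enlarged triangle, which covers no
  vertex at all.\<close>

lemma saving_corner_0:
  assumes "c mod 7 = 0" "d \<ge> 4"
  shows "saving d c 1 {p. fst p \<le> 4}"
proof (rule savingI[of "{(2, -1), (0, 0), (3, 2), (4, 5)}" _ _ _ "{(1, 1), (3, 1), (4, 4)}"])
  \<comment> \<open>0, 7 and 14 are the values of \<open>a + 2 * b\<close> on the removed
    points.\<close>
  have "- c mod 7 = 0" "(7 - c) mod 7 = 0" "(14 - c) mod 7 = 0" using assms(1) by presburger+
  then show "{(2, -1), (0, 0), (3, 2), (4, 5)} \<subseteq> ext_code d c \<inter> {p. fst p \<le> 4}"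
    using assms(2) by (simp add: ext_code_def)
  show "\<forall>u\<in>{(2, -1), (0, 0), (3, 2), (4, 5)}. \<forall>v\<in>nbhd u.
      v \<in> T_verts d \<longrightarrow> (\<exists>w\<in>{(1, 1), (3, 1), (4, 4)}. near w v)"
    by (simp add: nbhd_def near_def T_verts_def)
qed (use assms(2) in \<open>auto simp: T_verts_def\<close>)

text \<open>There is slack because \<open>(4, -1)\<close>, \<open>(0, 1)\<close> and
  \<open>(7, 8)\<close> lie outside the triangle and see at most two vertices each.\<close>

lemma saving_corner_2:
  assumes "c mod 7 = 2" "d \<ge> 7"
  shows "saving d c 1 {p. fst p \<le> 7}"
proof (rule savingI[of "{(4, -1), (2, 0), (0, 1), (5, 2), (3, 3), (6, 5), (7, 8)}" _ _ _
      "{(1, 1), (3, 1), (4, 4), (5, 1), (6, 4), (7, 7)}"])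
  have "(2 - c) mod 7 = 0" "(9 - c) mod 7 = 0" "(16 - c) mod 7 = 0" "(23 - c) mod 7 = 0"
    using assms(1) by presburger+
  then show "{(4, -1), (2, 0), (0, 1), (5, 2), (3, 3), (6, 5), (7, 8)} \<subseteq> ext_code d c \<inter> {p. fst p \<le> 7}"
    using assms(2) by (simp add: ext_code_def)
  show "\<forall>u\<in>{(4, -1), (2, 0), (0, 1), (5, 2), (3, 3), (6, 5), (7, 8)}. \<forall>v\<in>nbhd u.
      v \<in> T_verts d \<longrightarrow> (\<exists>w\<in>{(1, 1), (3, 1), (4, 4), (5, 1), (6, 4), (7, 7)}. near w v)"
    by (simp add: nbhd_def near_def T_verts_def)
qed (use assms(2) in \<open>auto simp: T_verts_def\<close>)

lemma saving_corner_3: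
  assumes "c mod 7 = 3"
  shows "saving d c 1 {p. fst p \<le> 2}"
proof (rule savingI[of "{(-2, -1)}" _ _ _ "{}"])
  have "(-4 - c) mod 7 = 0" using assms(1) by presburger
  then show "{(-2, -1)} \<subseteq> ext_code d c \<inter> {p. fst p \<le> 2}"
    by (simp add: ext_code_def)
  show "\<forall>u\<in>{(-2, -1)}. \<forall>v\<in>nbhd u.
      v \<in> T_verts d \<longrightarrow> (\<exists>w\<in>{}. near w v)"
    by (simp add: nbhd_def near_def T_verts_def)
qed auto

text \<open>The two outer points see only \<open>(0, 0)\<close>, \<open>(1, 0)\<close> and
  \<open>(1, 1)\<close>, \<open>(2, 2)\<close>, all in the closed neighbourhood of
  \<open>(1, 1)\<close>.\<close>

lemma saving_corner_5:
  assumes "c mod 7 = 5" "d \<ge> 2"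
  shows "saving d c 1 {p. fst p \<le> 2}"
proof (rule savingI[of "{(0, -1), (1, 2)}" _ _ _ "{(1, 1)}"])
  have "(-2 - c) mod 7 = 0" "(5 - c) mod 7 = 0" using assms(1) by presburger+
  then show "{(0, -1), (1, 2)} \<subseteq> ext_code d c \<inter> {p. fst p \<le> 2}"
    using assms(2) by (simp add: ext_code_def)
  show "\<forall>u\<in>{(0, -1), (1, 2)}. \<forall>v\<in>nbhd u.
      v \<in> T_verts d \<longrightarrow> (\<exists>w\<in>{(1, 1)}. near w v)"
    by (simp add: nbhd_def near_def T_verts_def)
qed (use assms(2) in \<open>auto simp: T_verts_def\<close>)

lemma saving_corner_6:
  assumes "c mod 7 = 6" "d \<ge> 2"
  shows "saving d c 1 {p. fst p \<le> 2}"
proof (rule savingI[of "{(1, -1), (-1, 0)}" _ _ _ "{(1, 0)}"])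
  have "(-1 - c) mod 7 = 0" using assms(1) by presburger
  then show "{(1, -1), (-1, 0)} \<subseteq> ext_code d c \<inter> {p. fst p \<le> 2}"
    using assms(2) by (simp add: ext_code_def)
  show "\<forall>u\<in>{(1, -1), (-1, 0)}. \<forall>v\<in>nbhd u.
      v \<in> T_verts d \<longrightarrow> (\<exists>w\<in>{(1, 0)}. near w v)"
    by (simp add: nbhd_def near_def T_verts_def)
qed (use assms(2) in \<open>auto simp: T_verts_def\<close>)

section \<open>Counting the code points\<close>

text \<open>A sum over natural numbers, so that small values can be evaluated by
  \<open>code_simp\<close>.\<close>

definition col_count :: "nat \<Rightarrow> nat \<Rightarrow> nat" where
  "col_count c a = (\<Sum>b\<le>a. of_bool ((a + 2 * b) mod 7 = c))"

definition code_count :: "nat \<Rightarrow> nat \<Rightarrow> nat" where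
  "code_count c n = (\<Sum>a\<le>n. col_count c a)"

lemma sum_atMost_add_7:
  fixes f :: "nat \<Rightarrow> 'a::comm_monoid_add"
  shows "(\<Sum>i\<le>n + 7. f i) =
    (\<Sum>i\<le>n. f i) + (f (n + 1) + f (n + 2) + f (n + 3) + f (n + 4) + f (n + 5) + f (n + 6) + f (n + 7))"
  by (simp add: eval_nat_numeral add.assoc)

text \<open>As 2 is coprime to 7, seven steps of 2 meet each class once.\<close>

lemma residues_mod_7:
  fixes c t :: nat
  assumes "c < 7"
  shows "of_bool ((t + 2) mod 7 = c) + of_bool ((t + 4) mod 7 = c) + of_bool ((t + 6) mod 7 = c) +
    of_bool ((t + 8) mod 7 = c) + of_bool ((t + 10) mod 7 = c) + of_bool ((t + 12) mod 7 = c) +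
    of_bool ((t + 14) mod 7 = c) = (1 :: nat)"
proof -
  define r where "r = t mod 7"
  have "(t + k) mod 7 = (r + k) mod 7" for k by (simp add: r_def mod_add_left_eq)
  moreover have "r \<in> {0, 1, 2, 3, 4, 5, 6}" using mod_less_divisor[of 7 t] unfolding r_def by auto
  moreover have "c \<in> {0, 1, 2, 3, 4, 5, 6}" using assms by auto
  ultimately show ?thesis by (simp only: insert_iff empty_iff simp_thms) (elim disjE; simp)
qed

lemma col_count_add_7:
  assumes "c < 7"
  shows "col_count c (a + 7) = col_count c a + 1"
proof -
  have "(a + 7 + 2 * b) mod 7 = (a + 2 * b) mod 7" for b
    by (metis add.assoc add.commute mod_add_self2)
  moreover have "a + 2 * (a + 1) = 3 * a + 2" "a + 2 * (a + 2) = 3 * a + 4" "a + 2 * (a + 3) = 3 * a + 6"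
    "a + 2 * (a + 4) = 3 * a + 8" "a + 2 * (a + 5) = 3 * a + 10" "a + 2 * (a + 6) = 3 * a + 12"
    "a + 2 * (a + 7) = 3 * a + 14" by simp_all
  ultimately show ?thesis
    unfolding col_count_def by (simp only: sum_atMost_add_7 residues_mod_7[OF assms])
qed

text \<open>Columns 1 to 7 have 35 points, 5 in each class. Sliding the window by one replaces a
  column by the one 7 further on, which adds 1.\<close>

lemma seven_col_count:
  assumes "c < 7"
  shows "(\<Sum>j<7. col_count c (n + 1 + j)) = n + 5"
proof (induction n)
  case 0
  have "c \<in> {0, 1, 2, 3, 4, 5, 6}" using assms by auto
  then show ?case
    by (elim insertE emptyE; simp only:; code_simp)
next
  case (Suc n)
  have "(\<Sum>j<7. col_count c (Suc n + 1 + j)) + col_count c (n + 1) =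
      (\<Sum>j<7. col_count c (n + 1 + j)) + col_count c (n + 1 + 7)"
    by (simp add: eval_nat_numeral)
  then show ?case using Suc.IH col_count_add_7[OF assms, of "n + 1"] by linarith
qed

lemma code_count_add_7:
  assumes "c < 7"
  shows "code_count c (n + 7) = code_count c n + n + 5"
proof -
  have "code_count c (n + 7) = code_count c n + (\<Sum>j<7. col_count c (n + 1 + j))"
    by (simp add: code_count_def eval_nat_numeral)
  then show ?thesis using seven_col_count[OF assms] by simp
qed

text \<open>Summing the increments of \<open>code_count_add_7\<close> gives an arithmetic series;
  doubling avoids its division by 2.\<close>

lemma code_count_closed_form:
  assumes "c < 7"
  shows "2 * code_count c (7 * q + n) = 2 * code_count c n + 7 * q\<^sup>2 + (2 * n + 3) * q"
proof (induction q)
  case (Suc q)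
  have eq: "7 * Suc q + n = (7 * q + n) + 7" by simp
  have "2 * code_count c (7 * Suc q + n) = 2 * code_count c (7 * q + n) + 2 * (7 * q + n + 5)"
    unfolding eq code_count_add_7[OF assms] by simp
  then show ?case using Suc.IH by (simp add: power2_eq_square algebra_simps)
qed simp

lemma col_count_eq_card: "col_count c a = card {b. b \<le> a \<and> (a + 2 * b) mod 7 = c}"
  unfolding col_count_def by (simp add: sum_of_bool_eq atMost_def Collect_conj_eq)

text \<open>Translation by \<open>(2, 1)\<close> carries the enlarged triangle to
  \<open>T_verts (d + 3)\<close> and raises \<open>a + 2 * b\<close> by 4.\<close>

lemma card_ext_code:
  assumes "int c' = (c + 4) mod 7"
  shows "card (ext_code d c) = code_count c' (d + 3)"
proof -
  let ?B = "\<lambda>a. {b. b \<le> a \<and> (a + 2 * b) mod 7 = c'}"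
  have mod: "(a + 2 * b) mod 7 = c' \<longleftrightarrow> (int a - 2 + 2 * (int b - 1) - c) mod 7 = 0" for a b
  proof -
    have "(a + 2 * b) mod 7 = c' \<longleftrightarrow> int ((a + 2 * b) mod 7) = int c'" by linarith
    also have "\<dots> \<longleftrightarrow> (int a + 2 * int b) mod 7 = (c + 4) mod 7"
      by (simp add: zmod_int assms)
    also have "\<dots> \<longleftrightarrow> (int a + 2 * int b - (c + 4)) mod 7 = 0"
      by (simp only: mod_eq_dvd_iff dvd_eq_mod_eq_0)
    also have "int a + 2 * int b - (c + 4) = int a - 2 + 2 * (int b - 1) - c" by simp
    finally show ?thesis .
  qed
  let ?f = "\<lambda>(a, b). (int a - 2, int b - 1)"
  have "?f ` (SIGMA a:{..d + 3}. ?B a) = ext_code d c"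
  proof (intro equalityI subsetI)
    fix p assume "p \<in> ?f ` (SIGMA a:{..d + 3}. ?B a)"
    then obtain a b where p: "p = (int a - 2, int b - 1)" "a \<le> d + 3" "b \<le> a" "(a + 2 * b) mod 7 = c'"
      by auto
    show "p \<in> ext_code d c"
      using p(2,3) p(4)[unfolded mod] unfolding p(1) ext_code_def mem_Collect_eq prod.case by linarith
  next
    fix p assume p: "p \<in> ext_code d c"
    define a b where "a = nat (fst p + 2)" and "b = nat (snd p + 1)"
    have bounds: "- 1 \<le> snd p" "snd p - 1 \<le> fst p" "fst p \<le> int d + 1"
      and *: "(fst p + 2 * snd p - c) mod 7 = 0"
      using p unfolding ext_code_def mem_Collect_eq case_prod_beta by blast+
    have ab: "fst p = int a - 2" "snd p = int b - 1" using bounds by (simp_all add: a_def b_def)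
    have "a \<le> d + 3" "b \<le> a" using bounds unfolding ab by linarith+
    moreover have "(a + 2 * b) mod 7 = c'" using * unfolding mod ab .
    ultimately have "(a, b) \<in> (SIGMA a:{..d + 3}. ?B a)" by blast
    moreover have "p = ?f (a, b)" by (simp add: prod_eq_iff ab)
    ultimately show "p \<in> ?f ` (SIGMA a:{..d + 3}. ?B a)" by (rule rev_image_eqI)
  qed
  moreover have "inj_on ?f X" for X by (auto simp: inj_on_def)
  ultimately have "bij_betw ?f (SIGMA a:{..d + 3}. ?B a) (ext_code d c)"
    by (simp add: bij_betw_def)
  then have "card (ext_code d c) = card (SIGMA a:{..d + 3}. ?B a)"
    by (rule bij_betw_same_card[symmetric])
  also have "\<dots> = (\<Sum>a\<le>d + 3. card (?B a))" by (rule card_SigmaI) auto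
  also have "\<dots> = code_count c' (d + 3)" by (simp only: code_count_def col_count_eq_card)
  finally show ?thesis .
qed

lemma code_count_init:
  "code_count 2 3 = 2" "code_count 3 4 = 3" "code_count 2 5 = 3" "code_count 5 6 = 4"
  "code_count 0 7 = 6" "code_count 4 8 = 6" "code_count 6 9 = 8"
  by code_simp+

section \<open>Choice of a code class for each residue of \<open>d\<close> modulo 7\<close>

theorem theorem2:
  fixes d q \<beta> :: nat
  assumes "d = 7 * q + \<beta>" and "q \<ge> 1" and "\<beta> \<le> 6"
  shows "real (domination_number (T_verts d) tri_adj)
           \<le> 3.5 * real q ^ 2 + (real \<beta> + 4.5) * real q + real \<beta> - 1"
proof -
  let ?g = "domination_number (T_verts d) tri_adj"
  \<comment> \<open>The closed form at \<open>\<beta> + 3\<close> already gives the coefficients of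
    \<open>q\<close>; the last premise says that the savings bring the constant down to
    \<open>\<beta> - 1\<close>.\<close>
  have main: ?thesis
    if "saving d c k1 {p. fst p \<le> r1}" "saving d (int d + 2 * c) k2 {p. fst p \<le> r2}"
      "saving d (3 * int d + 4 * c) k3 {p. fst p \<le> r3}"
      "r1 + r2 < int d - 1" "r2 + r3 < int d - 1" "r3 + r1 < int d - 1"
      "int c' = (c + 4) mod 7" "code_count c' (\<beta> + 3) + 1 = \<beta> + (k1 + k2 + k3)"
    for c c' k1 k2 k3 r1 r2 r3
  proof -
    have "c' < 7" using that(7) by (simp flip: of_nat_less_iff[where 'a = int])
    have "?g + (k1 + k2 + k3) \<le> code_count c' (d + 3)"
      using saving_three_corners[OF that(1-6)] card_ext_code[OF that(7)] by simp
    moreover have "2 * code_count c' (d + 3) =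
        2 * code_count c' (\<beta> + 3) + 7 * q\<^sup>2 + (2 * (\<beta> + 3) + 3) * q"
      using code_count_closed_form[OF \<open>c' < 7\<close>, of q "\<beta> + 3"] by (simp add: assms(1) add.assoc)
    ultimately have "2 * ?g + 2 \<le> 2 * \<beta> + 7 * q\<^sup>2 + (2 * (\<beta> + 3) + 3) * q"
      using that(8) by linarith
    then have "real (2 * ?g + 2) \<le> real (2 * \<beta> + 7 * q\<^sup>2 + (2 * (\<beta> + 3) + 3) * q)"
      by (simp only: of_nat_le_iff)
    then show ?thesis by (simp add: field_simps)
  qed
  have d: "int d = 7 * int q + int \<beta>" "int q \<ge> 1" using assms by auto
  \<comment> \<open>The instances below list \<open>c\<close>, then \<open>k\<close> and
    \<open>r\<close> for each corner, then \<open>c'\<close>. The corners have classes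
    \<open>c\<close>, \<open>\<beta> + 2 * c\<close> and \<open>3 * \<beta> + 4 * c\<close> modulo
    7; with \<open>saving_0\<close> the radius 2 is a placeholder.\<close>
  consider "\<beta> = 0" | "\<beta> = 1" | "\<beta> = 2" | "\<beta> = 3" | "\<beta> = 4" | "\<beta> = 5" | "\<beta> = 6"
    using assms(3) by linarith
  then show ?thesis
  proof cases
    case 1
    show ?thesis
      by (rule main[of 5 1 2 1 2 1 2 2, OF saving_corner_5 saving_corner_3 saving_corner_6])
        (use 1 d code_count_init in \<open>(simp; fail) | presburger\<close>)+
  next
    case 2
    show ?thesis
      by (rule main[of 6 1 2 1 2 1 2 3, OF saving_corner_6 saving_corner_6 saving_corner_6])
        (use 2 d code_count_init in \<open>(simp; fail) | presburger\<close>)+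
  next
    case 3
    show ?thesis
      by (rule main[of 5 1 2 1 2 0 2 2, OF saving_corner_5 saving_corner_5 saving_0])
        (use 3 d code_count_init in \<open>(simp; fail) | presburger\<close>)+
  next
    case 4
    show ?thesis
      by (rule main[of 1 0 2 1 2 1 2 5, OF saving_0 saving_corner_5 saving_corner_6])
        (use 4 d code_count_init in \<open>(simp; fail) | presburger\<close>)+
  next
    case 5
    show ?thesis
      by (rule main[of 3 1 2 1 2 1 2 0, OF saving_corner_3 saving_corner_3 saving_corner_3])
        (use 5 d code_count_init in \<open>(simp; fail) | presburger\<close>)+
  next
    case 6
    show ?thesis
      by (rule main[of 0 1 4 1 2 0 2 4, OF saving_corner_0 saving_corner_5 saving_0])
        (use 6 d code_count_init in \<open>(simp; fail) | presburger\<close>)+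
  next
    case 7
    show ?thesis
      by (rule main[of 2 1 7 1 2 1 2 6, OF saving_corner_2 saving_corner_3 saving_corner_5])
        (use 7 d code_count_init in \<open>(simp; fail) | presburger\<close>)+
  qed
qed

end
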